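(* Let $\psi:\mathbb{R}\to[0,\infty]$ be a function such that $H(x)=\frac{1}{1+\psi(x)}$, $x\in\mathbb{R}$, is a distribution function. Then for every integer $k>0$ and every real $a>0$, the function $$x\mapsto \left\{\frac{1}{1+a\psi(x)}\right\}^{1/k},\quad x\in\mathbb{R},$$ is also a distribution function.
   Context: A distribution function on $\mathbb{R}$ is a nondecreasing, right-continuous function $F:\mathbb{R}\to[0,1]$ with limit $0$ at $-\infty$ and limit $1$ at $+\infty$. Convention: $\psi(x)=\infty$ exactly where $H(x)=0$, with $\frac{1}{1+\infty}=0$ and $a\cdot\infty=\infty$ for $a>0$. *)

theory Defs
  imports "HOL-Library.Extended_Nonnegative_Real"
begin

definition distribution_function :: "(real \<Rightarrow> real) \<Rightarrow> bool" where
  "distribution_function F \<longleftrightarrow>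
     range F \<subseteq> {0..1} \<and>
     mono F \<and>
     (\<forall>x. continuous (at_right x) F) \<and>
     (F \<longlongrightarrow> 0) at_bot \<and>
     (F \<longlongrightarrow> 1) at_top"

(* The arithmetic is that of ennreal, where 1 / (1 + \<infinity>) = 0 and
   ennreal a * \<infinity> = \<infinity> for a > 0. The quotient is always at most 1,
   so enn2real loses nothing. *)
definition inv_one_plus :: "ennreal \<Rightarrow> real" where
  "inv_one_plus t = enn2real (1 / (1 + t))"

end

theory Submission
  imports Defs
begin

text \<open>
  With \<open>H = 1 / (1 + \<psi>)\<close>, the new function depends on \<open>x\<close> only through \<open>H x\<close>: since
  \<open>\<psi> = (1 - H) / H\<close>, it equals \<open>g (H x)\<close> for the transfer function
  \<open>g h = (h / (h + a (1 - h))) powr (1 / k)\<close>. On the unit interval \<open>g\<close> is continuous and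
  nondecreasing and fixes both endpoints, and composing a distribution function with any such \<open>g\<close>
  yields a distribution function (\<open>distribution_function_compose\<close>). Writing \<open>g\<close> in terms of \<open>h\<close>
  instead of \<open>\<psi>\<close> removes the infinite value: the points where \<open>\<psi>\<close> is infinite become \<open>h = 0\<close>,
  where the denominator of \<open>g\<close> is \<open>a > 0\<close>.
\<close>

text \<open>
  Continuity relative to the closed unit interval suffices for all three limit conditions at once,
  because every value of \<open>F\<close> and every limit involved, \<open>0\<close> and \<open>1\<close> included, lies in that interval.
\<close>

lemma distribution_function_compose:
  fixes F g :: "real \<Rightarrow> real"
  assumes F: "distribution_function F"
    and cont: "continuous_on {0..1} g"
    and mono: "mono_on {0..1} g"
    and g0: "g 0 = 0" and g1: "g 1 = 1"
  shows "distribution_function (\<lambda>x. g (F x))"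
proof -
  have mem: "F x \<in> {0..1}" for x
    using F rangeI[of F x] by (simp only: distribution_function_def) (blast dest: subsetD)
  have lim: "((\<lambda>x. g (F x)) \<longlongrightarrow> g l) A" if "(F \<longlongrightarrow> l) A" "l \<in> {0..1}" for l A
    by (rule continuous_on_tendsto_compose[OF cont that]) (use mem in simp)
  have "g (F x) \<in> {0..1}" for x
    using mono_onD[OF mono, of 0 "F x"] mono_onD[OF mono, of "F x" 1] mem[of x] g0 g1 by auto
  moreover have "mono (\<lambda>x. g (F x))"
    using F mem by (auto simp: distribution_function_def mono_def intro!: mono_onD[OF mono])
  moreover have "continuous (at_right x) (\<lambda>x. g (F x))" for x
    using F lim[OF _ mem] by (auto simp: distribution_function_def continuous_within)
  moreover have "((\<lambda>x. g (F x)) \<longlongrightarrow> 0) at_bot" "((\<lambda>x. g (F x)) \<longlongrightarrow> 1) at_top"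
    using F lim[of 0 at_bot] lim[of 1 at_top] g0 g1 by (auto simp: distribution_function_def)
  ultimately show ?thesis
    by (auto simp: distribution_function_def)
qed

lemma inv_one_plus_ennreal:
  assumes "r \<ge> 0"
  shows "inv_one_plus (ennreal r) = 1 / (1 + r)"
proof -
  have "1 / (1 + ennreal r) = ennreal (1 / (1 + r))"
    using assms by (simp add: divide_ennreal flip: ennreal_1 ennreal_plus)
  then show ?thesis
    using assms by (simp add: inv_one_plus_def)
qed

lemma inv_one_plus_top: "inv_one_plus top = 0"
  by (simp add: inv_one_plus_def)

text \<open>
  For finite \<open>t\<close> this is \<open>t = (1 - h) / h\<close> substituted into \<open>1 / (1 + a t)\<close> and cleared of the inner
  denominator. Clearing it is what makes the formula correct also at \<open>t = \<infinity>\<close>, that is \<open>h = 0\<close>.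
\<close>

lemma inv_one_plus_mult:
  fixes a :: real
  assumes "a > 0"
  shows "inv_one_plus (ennreal a * t) =
    inv_one_plus t / (inv_one_plus t + a * (1 - inv_one_plus t))"
proof (cases t)
  case (real r)
  then have "1 + r > 0" "1 + a * r > 0"
    using assms by (auto intro: add_pos_nonneg)
  moreover have "inv_one_plus (ennreal a * t) = 1 / (1 + a * r)"
    using real assms by (simp add: inv_one_plus_ennreal flip: ennreal_mult)
  moreover have "1 / (1 + r) + a * (1 - 1 / (1 + r)) = (1 + a * r) / (1 + r)"
    using \<open>1 + r > 0\<close> by (simp add: field_simps)
  ultimately show ?thesis
    using real by (simp add: inv_one_plus_ennreal)
next
  case top
  then show ?thesis
    using assms by (simp add: inv_one_plus_top ennreal_mult_top)
qed

theorem theorem2p1: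
  fixes \<psi> :: "real \<Rightarrow> ennreal" and k :: nat and a :: real
  assumes "distribution_function (\<lambda>x. inv_one_plus (\<psi> x))"
    and "k > 0"
    and "a > 0"
  shows "distribution_function (\<lambda>x. inv_one_plus (ennreal a * \<psi> x) powr (1 / real k))"
proof -
  define q :: "real \<Rightarrow> real" where "q h = h / (h + a * (1 - h))" for h
  have den: "h + a * (1 - h) > 0" if "h \<in> {0..1}" for h
    using that \<open>a > 0\<close> by (cases "h = 0") (auto intro: add_pos_nonneg)
  have q_nonneg: "q h \<ge> 0" if "h \<in> {0..1}" for h
    using that den[OF that] by (simp add: q_def)
  have q_mono: "q h \<le> q h'" if "h \<in> {0..1}" "h' \<in> {0..1}" "h \<le> h'" for h h'
  proof -
    \<comment> \<open>Cross-multiplied, the terms \<open>h * h'\<close> cancel and only \<open>a * h \<le> a * h'\<close> remains.\<close>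
    have "h * (h' + a * (1 - h')) \<le> h' * (h + a * (1 - h))"
      using mult_left_mono[OF \<open>h \<le> h'\<close>, of a] \<open>a > 0\<close> by (simp add: algebra_simps)
    then show ?thesis
      using den[OF that(1)] den[OF that(2)] by (simp add: q_def divide_le_eq le_divide_eq)
  qed
  have "continuous_on {0..1} q"
    unfolding q_def using den by (intro continuous_intros) force
  \<comment> \<open>The base vanishes at \<open>h = 0\<close>, where the power is continuous because its exponent is positive.\<close>
  then have "continuous_on {0..1} (\<lambda>h. q h powr (1 / real k))"
    using \<open>k > 0\<close> q_nonneg by (intro continuous_on_powr' continuous_on_const) auto
  moreover have "mono_on {0..1} (\<lambda>h. q h powr (1 / real k))"
    using q_mono q_nonneg by (auto intro!: mono_onI powr_mono2)
  ultimately have "distribution_function (\<lambda>x. q (inv_one_plus (\<psi> x)) powr (1 / real k))"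
    by (intro distribution_function_compose[OF assms(1)]) (auto simp: q_def)
  then show ?thesis
    using \<open>a > 0\<close> by (simp add: q_def inv_one_plus_mult)
qed

end
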